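(* Let $d\ge 2$ and let $p \in \mathbb{R}[x_1,\ldots,x_d]$. If $p(\boldsymbol{x})\ge 0$ for all $\boldsymbol{x}\in[0,\infty)^d$, then $T_p$ has the Stieltjes moment property.
   Context: $\mathbb{N}_0$ denotes the set of nonnegative integers and $\mathcal{A}$ the set of all real sequences $\alpha=(\alpha_n)_{n\in\mathbb{N}_0}$. A sequence $\alpha\in\mathcal{A}$ is a Stieltjes moment sequence if there is a nonnegative Borel measure $\mu$ on $\mathbb{R}$ with $\operatorname{supp}(\mu)\subset[0,\infty)$ such that $\alpha_n=\int_{[0,\infty)} x^n\,d\mu$ for all $n\in\mathbb{N}_0$ (all these integrals existing). For a polynomial $p=\sum_{\boldsymbol{i}\in\mathbb{N}_0^d} p_{\boldsymbol{i}}\,x_1^{i_1}\cdots x_d^{i_d}\in\mathbb{R}[x_1,\ldots,x_d]$ (where $\boldsymbol{i}=(i_1,\ldots,i_d)$), the map $T_p:\mathcal{A}\to\mathcal{A}$ is defined by $T_p(\alpha)=(\tilde\alpha_n)_{n\in\mathbb{N}_0}$ with $\tilde\alpha_n=\sum_{\boldsymbol{i}} p_{\boldsymbol{i}}\,\alpha_{n+i_1}\alpha_{n+i_2}\cdots\alpha_{n+i_d}$. $T_p$ has the Stieltjes moment property if, for every Stieltjes moment sequence $\alpha$, the sequence $T_p(\alpha)$ is a Stieltjes moment sequence. *)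

theory Defs
  imports "HOL-Analysis.Analysis" "HOL-Library.Poly_Mapping"
begin

definition measure_support :: "'a::topological_space measure \<Rightarrow> 'a set" where
  "measure_support \<mu> = {x. \<forall>U. open U \<longrightarrow> x \<in> U \<longrightarrow> emeasure \<mu> U > 0}"

definition stieltjes_moment_sequence :: "(nat \<Rightarrow> real) \<Rightarrow> bool" where
  "stieltjes_moment_sequence \<alpha> \<longleftrightarrow>
     (\<exists>\<mu> :: real measure. sets \<mu> = sets borel \<and> measure_support \<mu> \<subseteq> {0..} \<and>
        (\<forall>n. set_integrable \<mu> {0..} (\<lambda>x. x ^ n) \<and>
             \<alpha> n = set_lebesgue_integral \<mu> {0..} (\<lambda>x. x ^ n)))"

text \<open>A multi-index is a finitely supported exponent function and a polynomial a finitely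
  supported map from multi-indices to coefficients. The variables of
  \<open>\<real>[x\<^sub>1, \<dots>, x\<^sub>d]\<close> are numbered \<open>0, \<dots>, d - 1\<close>.\<close>

type_synonym real_mpoly = "(nat \<Rightarrow>\<^sub>0 nat) \<Rightarrow>\<^sub>0 real"

definition polys_in :: "nat \<Rightarrow> real_mpoly set" where
  "polys_in d = {p. \<forall>i \<in> Poly_Mapping.keys p. Poly_Mapping.keys i \<subseteq> {..<d}}"

definition eval_poly :: "nat \<Rightarrow> real_mpoly \<Rightarrow> (nat \<Rightarrow> real) \<Rightarrow> real" where
  "eval_poly d p x =
     (\<Sum>i \<in> Poly_Mapping.keys p. Poly_Mapping.lookup p i *
        (\<Prod>j<d. x j ^ Poly_Mapping.lookup i j))"

text \<open>The map depends on \<open>d\<close> and not only on \<open>p\<close>: a variable with exponent \<open>0\<close> in a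
  monomial still contributes the factor \<open>\<alpha> n\<close>.\<close>

definition T_map :: "nat \<Rightarrow> real_mpoly \<Rightarrow> (nat \<Rightarrow> real) \<Rightarrow> (nat \<Rightarrow> real)" where
  "T_map d p \<alpha> = (\<lambda>n.
     \<Sum>i \<in> Poly_Mapping.keys p. Poly_Mapping.lookup p i *
        (\<Prod>j<d. \<alpha> (n + Poly_Mapping.lookup i j)))"

definition stieltjes_moment_property :: "((nat \<Rightarrow> real) \<Rightarrow> (nat \<Rightarrow> real)) \<Rightarrow> bool" where
  "stieltjes_moment_property T \<longleftrightarrow>
     (\<forall>\<alpha>. stieltjes_moment_sequence \<alpha> \<longrightarrow> stieltjes_moment_sequence (T \<alpha>))"

end

theory Submission
  imports Defs
begin

text \<open>If \<open>\<mu>\<close> represents \<open>\<alpha>\<close>, then by Fubini \<open>T\<^sub>p(\<alpha>)\<^sub>n\<close> is the integral of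
  \<open>p(x) (x\<^sub>1 \<cdots> x\<^sub>d)\<^sup>n\<close> against the \<open>d\<close>-fold product of \<open>\<mu>\<close> on \<open>[0, \<infinity>)\<^sup>d\<close>. Hence
  \<open>T\<^sub>p(\<alpha>)\<close> is represented by the image of the nonnegative measure with density \<open>p\<close> under
  \<open>x \<mapsto> x\<^sub>1 \<cdots> x\<^sub>d\<close>.\<close>

text \<open>Change of variables turns the n-th moment of the image under \<open>f\<close> of the
  measure with density \<open>w\<close> into the integral of \<open>w x * f x ^ n\<close>. As
  \<open>f\<close> is nonnegative, this image gives the open half-line of negative reals mass 0,
  which keeps its support in [0, infinity).\<close>

lemma stieltjes_moment_sequenceI:
  fixes M :: "'a measure" and w f :: "'a \<Rightarrow> real"
  assumes [measurable]: "w \<in> borel_measurable M" "f \<in> borel_measurable M"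
    and w: "\<And>x. x \<in> space M \<Longrightarrow> 0 \<le> w x" and f: "\<And>x. x \<in> space M \<Longrightarrow> 0 \<le> f x"
    and int: "\<And>n. integrable M (\<lambda>x. w x * f x ^ n)"
    and \<alpha>: "\<And>n. \<alpha> n = (LINT x|M. w x * f x ^ n)"
  shows "stieltjes_moment_sequence \<alpha>"
proof -
  define D where "D = density M w"
  define N where "N = distr D borel f"
  have fD [measurable]: "f \<in> borel_measurable D"
    unfolding D_def by simp
  have supp: "x \<ge> 0" if x: "x \<in> measure_support N" for x
  proof (rule ccontr)
    assume "\<not> x \<ge> 0"
    with x have "emeasure N {..<0} > 0"
      unfolding measure_support_def by auto
    moreover have "f -` {..<0} \<inter> space D = {}"
      using f by (force simp: D_def)
    ultimately show False
      unfolding N_def by (simp add: emeasure_distr)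
  qed
  have w_AE: "AE x in M. 0 \<le> w x"
    using w by auto
  \<comment> \<open>The set integral over \<open>{0..}\<close> pulls back to an integral with an
    indicator at \<open>f x\<close>; that indicator is 1 since \<open>f\<close> is
    nonnegative.\<close>
  have eq: "w x * (indicat_real {0..} (f x) * f x ^ n) = w x * f x ^ n" if "x \<in> space M" for x n
    using f[OF that] by simp
  have "integrable M (\<lambda>x. w x * (indicat_real {0..} (f x) * f x ^ n))" for n
    using int[of n] by (subst Bochner_Integration.integrable_cong[OF refl eq])
  then have "set_integrable N {0..} (\<lambda>x. x ^ n)" for n
    unfolding set_integrable_def N_def D_def
    by (simp add: integrable_distr_eq integrable_density w_AE)
  moreover have "\<alpha> n = set_lebesgue_integral N {0..} (\<lambda>x. x ^ n)" for n
    unfolding set_lebesgue_integral_def N_def D_def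
    by (simp add: integral_distr integral_density w_AE eq \<alpha> cong: Bochner_Integration.integral_cong)
  ultimately show ?thesis
    unfolding stieltjes_moment_sequence_def using supp
    by (intro exI[of _ N]) (auto simp: N_def)
qed

text \<open>Restricting the representing measure to [0, infinity) turns set integrals into ordinary
  ones and builds nonnegativity into the space, so that points of a product of copies of
  \<open>M\<close> have nonnegative coordinates.\<close>

lemma stieltjes_moment_sequenceE:
  assumes "stieltjes_moment_sequence \<alpha>"
  obtains M :: "real measure" where
    "finite_measure M" "space M = {0..}" "sets M = sets (restrict_space borel {0..})"
    "\<And>n. integrable M (\<lambda>x. x ^ n)" "\<And>n. \<alpha> n = (LINT x|M. x ^ n)"
proof -
  from assms obtain \<mu> :: "real measure" where
    sets: "sets \<mu> = sets borel" and int: "\<And>n. set_integrable \<mu> {0..} (\<lambda>x. x ^ n)"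
    and \<alpha>: "\<And>n. \<alpha> n = set_lebesgue_integral \<mu> {0..} (\<lambda>x. x ^ n)"
    unfolding stieltjes_moment_sequence_def by blast
  have space: "space \<mu> = UNIV"
    using sets_eq_imp_space_eq[OF sets] by simp
  define M where "M = restrict_space \<mu> {0..}"
  have M_int: "integrable M (\<lambda>x. x ^ n)" for n
    using int[of n] unfolding M_def set_integrable_def
    by (subst integrable_restrict_space) (simp_all add: sets space)
  have M_\<alpha>: "\<alpha> n = (LINT x|M. x ^ n)" for n
    using \<alpha>[of n] unfolding M_def set_lebesgue_integral_def
    by (subst integral_restrict_space) (simp_all add: sets space)
  \<comment> \<open>The zeroth moment is the integral of the constant 1, so its existence bounds the
    total mass; this later makes Fubini available.\<close>
  have "finite_measure M"
    using M_int[of 0] by (auto simp: integrable_iff_bounded intro!: finite_measureI)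
  moreover have "space M = {0..}"
    by (simp add: M_def space_restrict_space space)
  moreover have "sets M = sets (restrict_space borel {0..})"
    unfolding M_def by (rule sets_restrict_space_cong[OF sets])
  ultimately show thesis
    using M_int M_\<alpha> that by blast
qed

theorem theorem2p6:
  fixes d :: nat and p :: real_mpoly
  assumes "d \<ge> 2"
    and "p \<in> polys_in d"
    and "\<And>x :: nat \<Rightarrow> real. (\<forall>j<d. x j \<ge> 0) \<Longrightarrow> eval_poly d p x \<ge> 0"
  shows "stieltjes_moment_property (T_map d p)"
  unfolding stieltjes_moment_property_def
proof (intro allI impI)
  fix \<alpha> assume "stieltjes_moment_sequence \<alpha>"
  then obtain M :: "real measure" where
    fin: "finite_measure M" and space: "space M = {0..}"
    and sets: "sets M = sets (restrict_space borel {0..})"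
    and int: "\<And>n. integrable M (\<lambda>x. x ^ n)" and \<alpha>: "\<And>n. \<alpha> n = (LINT x|M. x ^ n)"
    by (rule stieltjes_moment_sequenceE) blast
  interpret finite_measure M by fact
  interpret product_sigma_finite "\<lambda>_ :: nat. M" ..
  define P where "P = Pi\<^sub>M {..<d} (\<lambda>_. M)"
  have nonneg: "0 \<le> x j" if "x \<in> space P" "j < d" for x j
    using that by (auto simp: P_def space_PiM space PiE_def Pi_def)
  \<comment> \<open>Measurability of the identity is read off from the existence of the first
    moment.\<close>
  have [measurable]: "(\<lambda>x. x) \<in> borel_measurable M"
    using borel_measurable_integrable[OF int[of 1]] by simp
  have coord [measurable]: "(\<lambda>x. x j) \<in> borel_measurable P" if "j < d" for j
    unfolding P_def using measurable_component_singleton[of j "{..<d}" "\<lambda>_. M"] that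
    by (intro measurable_compose[OF _ \<open>(\<lambda>x. x) \<in> borel_measurable M\<close>]) auto
  have mono_int: "integrable P (\<lambda>x. \<Prod>j<d. x j ^ k j)" for k
    unfolding P_def by (rule product_integrable_prod) (simp_all add: int)
  \<comment> \<open>Fubini splits the integral of a monomial into one-variable moments. The
    exponents \<open>k j\<close> will be n plus those of a monomial of \<open>p\<close>.\<close>
  have mono_eq: "(LINT x|P. (\<Prod>j<d. x j ^ k j)) = (\<Prod>j<d. \<alpha> (k j))" for k
    unfolding P_def by (subst product_integral_prod) (simp_all add: int \<alpha>)
  \<comment> \<open>The n-th power of the product raises the exponent of every variable by n, also
    of those absent from a monomial; this matches the shifted indices in
    \<open>T_map\<close>.\<close>
  have expand: "eval_poly d p x * (\<Prod>j<d. x j) ^ n =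
      (\<Sum>i \<in> Poly_Mapping.keys p. Poly_Mapping.lookup p i *
        (\<Prod>j<d. x j ^ (n + Poly_Mapping.lookup i j)))" for x n
    unfolding eval_poly_def
    by (simp add: sum_distrib_left power_add prod.distrib prod_power_distrib mult_ac)
  show "stieltjes_moment_sequence (T_map d p \<alpha>)"
  proof (rule stieltjes_moment_sequenceI)
    show "eval_poly d p \<in> borel_measurable P"
      unfolding eval_poly_def
      by (intro borel_measurable_sum borel_measurable_times borel_measurable_prod
          borel_measurable_power coord) auto
    show "(\<lambda>x. \<Prod>j<d. x j) \<in> borel_measurable P"
      by (intro borel_measurable_prod coord) auto
    show "0 \<le> eval_poly d p x" if "x \<in> space P" for x
      using assms(3) nonneg[OF that] by blast
    show "0 \<le> (\<Prod>j<d. x j)" if "x \<in> space P" for x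
      using nonneg[OF that] by (auto intro: prod_nonneg)
    show "integrable P (\<lambda>x. eval_poly d p x * (\<Prod>j<d. x j) ^ n)" for n
      unfolding expand
      by (intro Bochner_Integration.integrable_sum integrable_mult_right mono_int)
    show "T_map d p \<alpha> n = (LINT x|P. eval_poly d p x * (\<Prod>j<d. x j) ^ n)" for n
      unfolding expand by (simp add: T_map_def mono_int mono_eq)
  qed
qed

end
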